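(* Let $0<p<1$ and let $w$ be an integrable radial weight on the unit disk $\mathbb{D}$ such that $\liminf_{r\to 0^+} w(r)>0$. Then the Korenblum domination principle fails for the weighted Bergman space $A^p_w$; that is, for every $c\in(0,1)$ there exist $f,g\in A^p_w$ such that $|f(z)|\le |g(z)|$ whenever $c\le |z|<1$, but $\|f\|_{p,w}>\|g\|_{p,w}$.
   Context: $\mathbb{D}=\{z\in\mathbb{C}:|z|<1\}$ and $dA=\frac1\pi\,dx\,dy$ is the normalized Lebesgue area measure on $\mathbb{D}$. A weight is a measurable function $w:\mathbb{D}\to[0,\infty)$ with $\int_{\mathbb{D}} w\,dA>0$. It is integrable if $\int_{\mathbb{D}} w\,dA<\infty$, and radial if $w(z)=w(|z|)$ for all $z\in\mathbb{D}$. For $0<p<\infty$, $A^p_w$ is the set of all holomorphic functions $f$ in $\mathbb{D}$ with $\|f\|_{p,w}=\left(\int_{\mathbb{D}}|f|^p w\,dA\right)^{1/p}<\infty$ (the notation $\|\cdot\|_{p,w}$ is used also for $0<p<1$, although it is then not a norm). *)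

theory Defs
  imports "HOL-Analysis.Analysis"
begin

abbreviation unit_disc :: "complex set" where
  "unit_disc \<equiv> ball 0 1"

definition disc_area :: "complex measure" where
  "disc_area = density (lebesgue_on unit_disc) (\<lambda>_. ennreal (1 / pi))"

(* Only values on the disc matter; the positivity condition uses the nonnegative integral
   because a weight need not be integrable. *)
definition weight :: "(complex \<Rightarrow> real) \<Rightarrow> bool" where
  "weight w \<longleftrightarrow>
     w \<in> borel_measurable (lebesgue_on unit_disc) \<and>
     (\<forall>z\<in>unit_disc. 0 \<le> w z) \<and>
     (\<integral>\<^sup>+ z. ennreal (w z) \<partial>disc_area) > 0"

definition integrable_weight :: "(complex \<Rightarrow> real) \<Rightarrow> bool" where
  "integrable_weight w \<longleftrightarrow> weight w \<and> (\<integral>\<^sup>+ z. ennreal (w z) \<partial>disc_area) < \<infinity>"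

definition radial :: "(complex \<Rightarrow> real) \<Rightarrow> bool" where
  "radial w \<longleftrightarrow> (\<forall>z\<in>unit_disc. w z = w (complex_of_real (cmod z)))"

(* For a weight w and f holomorphic on the disc the integrand is measurable and nonnegative
   there, so integrability is finiteness of its integral. *)
definition bergman_space :: "real \<Rightarrow> (complex \<Rightarrow> real) \<Rightarrow> (complex \<Rightarrow> complex) set" where
  "bergman_space p w =
     {f. f holomorphic_on unit_disc \<and> integrable disc_area (\<lambda>z. cmod (f z) powr p * w z)}"

(* Meaningful on bergman_space p w only: the Bochner integral of a non-integrable function is 0. *)
definition bergman_norm :: "real \<Rightarrow> (complex \<Rightarrow> real) \<Rightarrow> (complex \<Rightarrow> complex) \<Rightarrow> real" where
  "bergman_norm p w f = (\<integral>z. cmod (f z) powr p * w z \<partial>disc_area) powr (1 / p)"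

end

theory Submission
  imports Defs "HOL-Complex_Analysis.Complex_Analysis"
begin

text \<open>
  Compare $g(z) = z^n$ with $f(z) = (1-d) z^n + d c^n$, so that $|f| \le |g|$ for $|z| \ge c$.
  Replacing $g$ by $(1-d) z^n$ costs at most order $d$. By rotation invariance and the mean value
  property, the mean of $|f|^p$ over each circle is at least the $p$-th power of the larger of the
  moduli of the two terms. So on a disc of radius $s$ proportional to $d^{1/n}$, where the constant
  term dominates, $f$ gains at least order $s^2 d^p$, that is, $d^{p+2/n}$. Since $p < 1$, this
  exceeds the cost once $n(1-p) > 2$ and $d$ is small. Below, $d$ is chosen so that $d c^n = 2 s^n$.
\<close>

section \<open>Rotation invariance of Lebesgue measure in the plane\<close>

text \<open>Lebesgue measure is determined by its values on boxes. The preimage of a box under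
  \<open>T\<close> is its image under \<open>inv T\<close>, which is again orthogonal and so
  preserves volume.\<close>

lemma distr_lborel_orthogonal:
  fixes T :: "real^'n::{finite,wellorder} \<Rightarrow> real^'n::_"
  assumes "orthogonal_transformation T"
  shows "distr lborel borel T = lborel"
proof (rule sym, rule lborel_eqI)
  fix l u :: "real^'n::_"
  assume le: "\<And>b. b \<in> Basis \<Longrightarrow> l \<bullet> b \<le> u \<bullet> b"
  have inv: "orthogonal_transformation (inv T)"
    using assms by (rule orthogonal_transformation_inv)
  have pre: "T -` box l u = inv T ` box l u"
    using orthogonal_transformation_bij[OF assms] by (simp add: bij_vimage_eq_inv_image)
  have borel: "T -` box l u \<in> sets borel"
    using linear_continuous_on[of T UNIV] orthogonal_transformation_linear[OF assms]
    by (metis borel_open linear_conv_bounded_linear linear_continuous_at open_box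
        continuous_on_eq_continuous_at open_UNIV open_vimage)
  have T: "T \<in> borel \<rightarrow>\<^sub>M borel"
    using orthogonal_transformation_linear[OF assms]
    by (simp add: borel_measurable_continuous_onI linear_continuous_on linear_linear)
  have "emeasure (distr lborel borel T) (box l u) = emeasure lebesgue (T -` box l u)"
    using T borel by (simp add: emeasure_distr)
  also have "\<dots> = ennreal (measure lebesgue (inv T ` box l u))"
    using measurable_orthogonal_image[OF inv, of "box l u"] pre
    by (simp add: emeasure_eq_measure2)
  also have "\<dots> = ennreal (measure lborel (box l u))"
    using measure_orthogonal_image[OF inv, of "box l u"] by simp
  also have "\<dots> = (\<Prod>b\<in>Basis. (u - l) \<bullet> b)"
    using le by (simp add: measure_lborel_box)
  finally show "emeasure (distr lborel borel T) (box l u) = (\<Prod>b\<in>Basis. (u - l) \<bullet> b)" .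
qed simp

text \<open>A bridge between two types: volume preservation by orthogonal maps is at hand on
  \<open>real^2\<close>, whereas the rotations of interest act on \<open>complex\<close>. The two
  measures agree on boxes.\<close>

lemma lborel_complex_eq_distr:
  "(lborel :: complex measure) = distr lborel borel (\<lambda>v::real^2. Complex (v $ 1) (v $ 2))"
proof (rule lborel_eqI)
  fix l u :: complex
  assume le: "\<And>b. b \<in> Basis \<Longrightarrow> l \<bullet> b \<le> u \<bullet> b"
  let ?K = "\<lambda>v::real^2. Complex (v $ 1) (v $ 2)"
  have K: "?K \<in> borel \<rightarrow>\<^sub>M borel"
    by (intro borel_measurable_continuous_onI continuous_intros continuous_on_Complex)
  have b: "(Basis :: (real^2) set) = {axis 1 1, axis 2 1}"
    by (auto simp: Basis_vec_def UNIV_2)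
  have ne: "axis 1 (1::real) \<noteq> (axis 2 1 :: real^2)"
    by (simp add: axis_eq_axis)
  have le': "Re l \<le> Re u" "Im l \<le> Im u"
    using le[of 1] le[of \<i>] by (auto simp: Basis_complex_def)
  have "?K -` box l u = box (vector [Re l, Im l]) (vector [Re u, Im u])"
    by (auto simp: mem_box b Basis_complex_def inner_axis)
  then have "emeasure (distr lborel borel ?K) (box l u)
      = emeasure lborel (box (vector [Re l, Im l]) (vector [Re u, Im u]) :: (real^2) set)"
    using K by (simp add: emeasure_distr)
  also have "\<dots> = (Re u - Re l) * (Im u - Im l)"
    using le' ne by (subst emeasure_lborel_box) (auto simp: b inner_axis)
  finally show "emeasure (distr lborel borel ?K) (box l u) = (\<Prod>b\<in>Basis. (u - l) \<bullet> b)"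
    by (simp add: Basis_complex_def)
qed simp

text \<open>In coordinates, multiplication by \<open>a\<close> is the linear map \<open>?T\<close>,
  which is orthogonal because \<open>a\<close> has modulus 1. Conjugating by \<open>?K\<close>
  carries the invariance over to \<open>complex\<close>.\<close>

lemma distr_lborel_rotation:
  fixes a :: complex
  assumes "cmod a = 1"
  shows "distr lborel borel ((*) a) = lborel"
proof -
  let ?K = "\<lambda>v::real^2. Complex (v $ 1) (v $ 2)"
  let ?T = "\<lambda>v::real^2. vector [Re a * v $ 1 - Im a * v $ 2, Re a * v $ 2 + Im a * v $ 1] :: real^2"
  have K: "?K \<in> borel \<rightarrow>\<^sub>M borel"
    by (intro borel_measurable_continuous_onI continuous_intros continuous_on_Complex)
  have a: "(Re a)\<^sup>2 + (Im a)\<^sup>2 = 1"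
    using assms by (metis cmod_power2 power_one)
  have lin: "linear ?T"
    by (rule linearI) (simp_all add: vec_eq_iff forall_2 algebra_simps)
  have nrm: "norm (?T v) = norm v" for v
  proof -
    \<comment> \<open>The two-square identity, that is, multiplicativity of the squared
      modulus.\<close>
    have "(Re a * x - Im a * y)\<^sup>2 + (Re a * y + Im a * x)\<^sup>2 = ((Re a)\<^sup>2 + (Im a)\<^sup>2) * (x\<^sup>2 + y\<^sup>2)"
      for x y by algebra
    with a show ?thesis
      by (simp add: norm_vec_def L2_set_def sum_2)
  qed
  have orth: "orthogonal_transformation ?T"
    using lin nrm by (simp add: orthogonal_transformation)
  have T: "?T \<in> borel \<rightarrow>\<^sub>M borel"
    using lin by (simp add: borel_measurable_continuous_onI linear_continuous_on linear_linear)
  have "distr lborel borel ((*) a) = distr (distr lborel borel ?K) borel ((*) a)"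
    using lborel_complex_eq_distr by simp
  also have "\<dots> = distr lborel borel ((*) a \<circ> ?K)"
    using K by (subst distr_distr) auto
  also have "(*) a \<circ> ?K = ?K \<circ> ?T"
    by (simp add: fun_eq_iff complex_eq_iff)
  also have "distr lborel borel \<dots> = distr (distr lborel borel ?T) borel ?K"
    using K T by (subst distr_distr) auto
  also have "\<dots> = distr lborel borel ?K"
    using distr_lborel_orthogonal[OF orth] by simp
  finally show ?thesis
    using lborel_complex_eq_distr by simp
qed

section \<open>Lower bounds for p-th power means over circles\<close>

text \<open>The principal branch of (1 + b u)^p is holomorphic in the open unit disc, as 1 + b u has
  positive real part there. By the mean value property its average over the unit circle is its value
  1 at the centre, and the average of the modulus is at least the modulus of the average.\<close>

lemma circle_mean_powr_ge_one:
  fixes b :: complex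
  assumes "cmod b \<le> 1" "p > 0"
  shows "1 \<le> (\<integral>\<^sup>+t\<in>{0..1}. ennreal (cmod (1 + b * cis (2 * pi * t)) powr p) \<partial>lborel)"
proof -
  let ?h = "\<lambda>u. (1 + b * u) powr (of_real p :: complex)"
  let ?e = "\<lambda>t::real. cis (2 * pi * t)"
  have e: "exp (2 * of_real pi * \<i> * of_real t) = ?e t" for t
    by (simp add: cis_conv_exp algebra_simps)
  have Re_le: "- Re (b * u) \<le> cmod b * cmod u" for u
    by (metis abs_Re_le_cmod abs_le_D2 norm_mult)
  have small: "cmod b * cmod u \<le> cmod u" for u
    using assms mult_right_mono[of "cmod b" 1 "cmod u"] by simp
  \<comment> \<open>If b has modulus 1, then 1 + b u vanishes at one boundary point. The power stays
    continuous there because the real part is nonnegative on the closed disc and p is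
    positive.\<close>
  have cont: "continuous_on (cball 0 1) ?h"
  proof (intro continuous_intros)
    show "cball 0 1 \<subseteq> {z. 0 \<le> Re (1 + b * z) \<or> Im (1 + b * z) \<noteq> 0}"
    proof
      fix z :: complex assume "z \<in> cball 0 1"
      then have "0 \<le> Re (1 + b * z)"
        using Re_le[of z] small[of z] by simp
      then show "z \<in> {z. 0 \<le> Re (1 + b * z) \<or> Im (1 + b * z) \<noteq> 0}" by blast
    qed
  qed (use assms in auto)
  have hol: "?h holomorphic_on ball 0 1"
  proof (intro holomorphic_intros)
    fix z :: complex assume "z \<in> ball 0 1"
    then have "0 < Re (1 + b * z)"
      using Re_le[of z] small[of z] by simp
    then show "1 + b * z \<notin> \<real>\<^sub>\<le>\<^sub>0"
      by (auto simp: complex_nonpos_Reals_iff)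
  qed
  have "((\<lambda>u. ?h u / (u - 0)) has_contour_integral (2 * of_real pi * \<i> * ?h 0)) (circlepath 0 1)"
    by (rule Cauchy_integral_circlepath[OF cont hol]) simp
  moreover have "circlepath 0 1 t = ?e t" for t
    by (simp add: circlepath e)
  \<comment> \<open>Parametrized over [0,1], the circle has derivative 2 pi i \<open>?e t\<close>,
    whose factor \<open>?e t\<close> cancels the Cauchy kernel. The constant 2 pi i is divided out
    afterwards.\<close>
  ultimately have "((\<lambda>t. ?h (?e t) / ?e t * (2 * of_real pi * \<i> * ?e t)) has_integral 2 * of_real pi * \<i>) {0..1}"
    by (simp add: has_contour_integral vector_derivative_circlepath e)
  then have scaled: "((\<lambda>t. (2 * of_real pi * \<i>) * ?h (?e t)) has_integral (2 * of_real pi * \<i>) * 1) {0..1}"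
    by (simp add: mult_ac)
  have cancel: "(h has_integral 1) {0..1}"
    if "((\<lambda>t. c * h t) has_integral c * 1) {0..1}" "c \<noteq> 0" for c :: complex and h :: "real \<Rightarrow> complex"
  proof -
    have "inverse c * (c * y) = y" for y
      using that(2) by simp
    then show ?thesis
      using has_integral_mult_right[OF that(1), of "inverse c"] by (simp only: mult_1_right left_inverse[OF that(2)])
  qed
  have int: "((\<lambda>t. ?h (?e t)) has_integral 1) {0..1}"
    by (rule cancel[OF scaled]) simp
  let ?m = "\<lambda>t. cmod (1 + b * ?e t) powr p"
  have m: "cmod (?h (?e t)) = ?m t" for t
    using assms by (simp add: norm_powr_real_powr')
  have "continuous_on {0..1} (\<lambda>t. cmod (?h (?e t)))"
    by (intro continuous_intros continuous_on_compose2[OF cont]) auto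
  then have mint: "?m integrable_on {0..1}"
    by (simp only: m integrable_continuous_interval)
  have "1 = cmod (integral {0..1} (\<lambda>t. ?h (?e t)))"
    by (simp only: integral_unique[OF int] norm_one)
  also have "\<dots> \<le> integral {0..1} ?m"
    by (rule integral_norm_bound_integral) (use int mint in \<open>simp_all only: m order_refl has_integral_integrable\<close>)
  finally have "1 \<le> integral {0..1} ?m" .
  moreover have "(\<integral>\<^sup>+t\<in>{0..1}. ennreal (?m t) \<partial>lborel) = ennreal (integral {0..1} ?m)"
    by (rule nn_integral_has_integral_lebesgue'[OF _ integrable_integral[OF mint]]) simp
  ultimately show ?thesis
    by (simp add: ennreal_ge_1)
qed

text \<open>By homogeneity, \<open>a\<close> factors out and \<open>b / a\<close> takes the role of
  \<open>b\<close> in the normalized case. For \<open>a = 0\<close> the left side is 0, since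
  \<open>0 powr p = 0\<close>.\<close>

lemma circle_mean_powr_ge:
  fixes a b :: complex
  assumes "cmod b \<le> cmod a" "p > 0"
  shows "ennreal (cmod a powr p) \<le> (\<integral>\<^sup>+t\<in>{0..1}. ennreal (cmod (a + b * cis (2 * pi * t)) powr p) \<partial>lborel)"
proof (cases "a = 0")
  case False
  have [measurable]: "(\<lambda>t. cmod (1 + b / a * cis (2 * pi * t))) \<in> borel_measurable borel"
    by (intro borel_measurable_continuous_onI continuous_intros)
  have "cmod (a + b * cis (2 * pi * t)) powr p
      = cmod a powr p * cmod (1 + b / a * cis (2 * pi * t)) powr p" for t
  proof -
    have "a + b * cis (2 * pi * t) = a * (1 + b / a * cis (2 * pi * t))"
      using False by (simp add: field_simps)
    then show ?thesis
      by (metis norm_ge_zero norm_mult powr_mult)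
  qed
  then have "(\<integral>\<^sup>+t\<in>{0..1}. ennreal (cmod (a + b * cis (2 * pi * t)) powr p) \<partial>lborel)
      = (\<integral>\<^sup>+t. ennreal (cmod a powr p)
          * (ennreal (cmod (1 + b / a * cis (2 * pi * t)) powr p) * indicator {0..1} t) \<partial>lborel)"
    by (intro nn_integral_cong) (simp only: ennreal_mult powr_ge_zero mult.assoc)
  also have "\<dots> = ennreal (cmod a powr p) * (\<integral>\<^sup>+t\<in>{0..1}. ennreal (cmod (1 + b / a * cis (2 * pi * t)) powr p) \<partial>lborel)"
    by (rule nn_integral_cmult) measurable
  finally have "(\<integral>\<^sup>+t\<in>{0..1}. ennreal (cmod (a + b * cis (2 * pi * t)) powr p) \<partial>lborel)
      = ennreal (cmod a powr p) * (\<integral>\<^sup>+t\<in>{0..1}. ennreal (cmod (1 + b / a * cis (2 * pi * t)) powr p) \<partial>lborel)" .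
  moreover have "1 \<le> (\<integral>\<^sup>+t\<in>{0..1}. ennreal (cmod (1 + b / a * cis (2 * pi * t)) powr p) \<partial>lborel)"
    using assms False by (intro circle_mean_powr_ge_one) (auto simp: norm_divide divide_simps)
  ultimately show ?thesis
    using mult_left_mono[of 1 _ "ennreal (cmod a powr p)"] by simp
qed simp

text \<open>Conjugating a + b e and multiplying by the unimodular number e keeps the modulus and
  yields cnj b + cnj a e. Thus the two coefficients may trade places, and the larger one can be
  taken as the constant term.\<close>

lemma circle_mean_powr_ge_max:
  fixes a b :: complex
  assumes "p > 0"
  shows "ennreal (max (cmod a) (cmod b) powr p)
    \<le> (\<integral>\<^sup>+t\<in>{0..1}. ennreal (cmod (a + b * cis (2 * pi * t)) powr p) \<partial>lborel)"
proof (cases "cmod b \<le> cmod a")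
  case True
  then show ?thesis
    using circle_mean_powr_ge[OF True assms] by (simp add: max_def)
next
  case False
  have "cmod (a + b * cis (2 * pi * t)) = cmod (cnj b + cnj a * cis (2 * pi * t))" for t
  proof -
    have "cmod (a + b * cis (2 * pi * t)) = cmod (cnj (a + b * cis (2 * pi * t)) * cis (2 * pi * t))"
      by (simp only: norm_mult complex_mod_cnj norm_cis mult_1_right)
    also have "cnj (a + b * cis (2 * pi * t)) * cis (2 * pi * t) = cnj b + cnj a * cis (2 * pi * t)"
      by (simp add: distrib_right cis_cnj cis_mult mult.assoc)
    finally show ?thesis .
  qed
  then show ?thesis
    using circle_mean_powr_ge[of "cnj a" "cnj b" p] False assms by (simp add: max_def)
qed

section \<open>Integrals against rotation-invariant measures and the perturbation inequality\<close>

text \<open>After exchanging the integrals, the integral over z does not depend on the angle by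
  invariance, and the range of \<open>t\<close> has length 1. Any speed \<open>k\<close> is allowed,
  so the average need not run over whole turns.\<close>

lemma nn_integral_rotation_average:
  fixes F :: "complex \<Rightarrow> ennreal"
  assumes "finite_measure \<mu>" and sets: "sets \<mu> = sets borel"
    and rot: "\<And>a. cmod a = 1 \<Longrightarrow> distr \<mu> borel ((*) a) = \<mu>"
    and F: "F \<in> borel_measurable borel"
  shows "(\<integral>\<^sup>+z. F z \<partial>\<mu>) = (\<integral>\<^sup>+z. (\<integral>\<^sup>+t\<in>{0..1}. F (cis (k * t) * z) \<partial>lborel) \<partial>\<mu>)"
proof -
  interpret finite_measure \<mu> by fact
  interpret pair_sigma_finite lborel \<mu> ..
  note [measurable_cong] = sets
  have [measurable]: "F \<in> borel_measurable borel" by (rule F)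
  have [measurable]: "(\<lambda>t. cis (k * t)) \<in> borel_measurable borel"
    by (intro borel_measurable_continuous_onI continuous_intros)
  have inv: "(\<integral>\<^sup>+z. F (cis s * z) \<partial>\<mu>) = (\<integral>\<^sup>+z. F z \<partial>\<mu>)" for s
  proof -
    have "(\<integral>\<^sup>+z. F z \<partial>\<mu>) = (\<integral>\<^sup>+z. F z \<partial>distr \<mu> borel ((*) (cis s)))"
      using rot[of "cis s"] by simp
    also have "\<dots> = (\<integral>\<^sup>+z. F (cis s * z) \<partial>\<mu>)"
      by (subst nn_integral_distr) simp_all
    finally show ?thesis ..
  qed
  have "(\<integral>\<^sup>+z. (\<integral>\<^sup>+t\<in>{0..1}. F (cis (k * t) * z) \<partial>lborel) \<partial>\<mu>)
      = (\<integral>\<^sup>+t. (\<integral>\<^sup>+z. F (cis (k * t) * z) * indicator {0..1} t \<partial>\<mu>) \<partial>lborel)"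
    by (rule Fubini') measurable
  also have "\<dots> = (\<integral>\<^sup>+t. (\<integral>\<^sup>+z. F z \<partial>\<mu>) * indicator {0..1::real} t \<partial>lborel)"
    by (simp add: nn_integral_multc inv)
  also have "\<dots> = (\<integral>\<^sup>+z. F z \<partial>\<mu>)"
    by (simp add: nn_integral_cmult_indicator)
  finally show ?thesis ..
qed

lemma nn_integral_powr_binomial_ge:
  fixes A B :: complex
  assumes \<mu>: "finite_measure \<mu>" "sets \<mu> = sets borel"
      "\<And>a. cmod a = 1 \<Longrightarrow> distr \<mu> borel ((*) a) = \<mu>"
    and "p > 0" "n > 0"
  shows "(\<integral>\<^sup>+z. ennreal (max (cmod A) (cmod B * cmod z ^ n) powr p) \<partial>\<mu>)
    \<le> (\<integral>\<^sup>+z. ennreal (cmod (A + B * z ^ n) powr p) \<partial>\<mu>)"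
proof -
  let ?F = "\<lambda>z. ennreal (cmod (A + B * z ^ n) powr p)"
  have "ennreal (max (cmod A) (cmod B * cmod z ^ n) powr p)
      \<le> (\<integral>\<^sup>+t\<in>{0..1}. ?F (cis (2 * pi / n * t) * z) \<partial>lborel)" for z
  proof -
    \<comment> \<open>With speed 2 pi / n, the power z^n turns exactly once as \<open>t\<close> runs
      over [0,1], so the inner average is a circle mean with coefficients \<open>A\<close> and
      \<open>B * z ^ n\<close>.\<close>
    have "(cis (2 * pi / n * t) * z) ^ n = z ^ n * cis (2 * pi * t)" for t
      using \<open>n > 0\<close> by (simp add: power_mult_distrib Complex.DeMoivre mult.commute)
    then show ?thesis
      using circle_mean_powr_ge_max[OF \<open>p > 0\<close>, of A "B * z ^ n"]
      by (simp add: norm_mult norm_power mult.assoc)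
  qed
  then have "(\<integral>\<^sup>+z. ennreal (max (cmod A) (cmod B * cmod z ^ n) powr p) \<partial>\<mu>)
      \<le> (\<integral>\<^sup>+z. (\<integral>\<^sup>+t\<in>{0..1}. ?F (cis (2 * pi / n * t) * z) \<partial>lborel) \<partial>\<mu>)"
    by (rule nn_integral_mono)
  also have "\<dots> = (\<integral>\<^sup>+z. ?F z \<partial>\<mu>)"
    by (rule nn_integral_rotation_average[OF \<mu>, symmetric]) simp_all
  finally show ?thesis .
qed

lemma integrable_bounded_on_disc:
  fixes h :: "complex \<Rightarrow> real"
  assumes "finite_measure \<mu>" "sets \<mu> = sets borel" "AE z in \<mu>. cmod z < 1"
    and "h \<in> borel_measurable borel" "\<And>z. cmod z < 1 \<Longrightarrow> \<bar>h z\<bar> \<le> C"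
  shows "integrable \<mu> h"
proof -
  interpret finite_measure \<mu> by fact
  note [measurable_cong] = assms(2)
  show ?thesis
    using assms(3-5) by (intro integrable_const_bound[of _ C]) (auto elim!: eventually_mono)
qed

text \<open>The quantitative core. Rotation averaging replaces the integrand \<open>?F\<close> by
  the larger modulus \<open>?M\<close>, and \<open>?M\<close> is bounded below by \<open>?L\<close>,
  which is (1 - d) \<open>?G\<close> plus a bonus \<open>?g\<close> on the small disc. The
  hypothesis \<open>small\<close> says that the bonus outweighs the loss, which is at most
  \<open>d\<close> times the total mass.\<close>

lemma integral_perturbation_gt:
  fixes p c K s :: real and n :: nat
  defines "d \<equiv> 2 * (s / c) ^ n"
  assumes \<mu>: "finite_measure \<mu>" "sets \<mu> = sets borel"
      "\<And>a. cmod a = 1 \<Longrightarrow> distr \<mu> borel ((*) a) = \<mu>"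
    and disc: "AE z in \<mu>. cmod z < 1"
    and p: "0 < p" "p < 1" and "n > 0" and "0 < c" and "0 < s" and "s < 1" and "d \<le> 1"
    and K: "K * s\<^sup>2 \<le> measure \<mu> (ball 0 s)"
    and small: "2 * measure \<mu> (space \<mu>) * s ^ n < c ^ n * (2 powr p - 1) * K * s\<^sup>2 * s powr (n * p)"
  shows "(\<integral>z. cmod (z ^ n) powr p \<partial>\<mu>)
    < (\<integral>z. cmod (of_real (2 * s ^ n) + of_real (1 - d) * z ^ n) powr p \<partial>\<mu>)"
proof -
  interpret finite_measure \<mu> by fact
  note [measurable_cong] = \<mu>(2)
  have d: "0 \<le> d"
    using \<open>0 < c\<close> \<open>0 < s\<close> by (simp add: d_def)
  let ?G = "\<lambda>z::complex. cmod (z ^ n) powr p"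
  let ?F = "\<lambda>z::complex. cmod (of_real (2 * s ^ n) + of_real (1 - d) * z ^ n) powr p"
  let ?M = "\<lambda>z::complex. max (2 * s ^ n) ((1 - d) * cmod z ^ n) powr p"
  let ?g = "(2 powr p - 1) * s powr (n * p)"
  let ?L = "\<lambda>z::complex. (1 - d) * ?G z + ?g * indicator (ball 0 s) z"
  have p2: "1 \<le> 2 powr p"
    using p by (simp add: ge_one_powr_ge_zero)
  have z1: "cmod z ^ n \<le> 1" if "cmod z < 1" for z :: complex
    using that by (simp add: power_le_one)
  have sn: "0 < s ^ n" "s ^ n \<le> 1"
    using \<open>0 < s\<close> \<open>s < 1\<close> by (simp_all add: power_le_one)
  have G_int: "integrable \<mu> ?G"
    using z1 p by (intro integrable_bounded_on_disc[OF \<mu>(1,2) disc, of _ 1])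
      (auto simp: norm_power powr_le1)
  have F_int: "integrable \<mu> ?F"
  proof (rule integrable_bounded_on_disc[OF \<mu>(1,2) disc, of _ "3 powr p"])
    fix z :: complex assume z: "cmod z < 1"
    have "cmod (of_real (2 * s ^ n) + of_real (1 - d) * z ^ n)
        \<le> cmod (of_real (2 * s ^ n)) + cmod (of_real (1 - d) * z ^ n)"
      by (rule norm_triangle_ineq)
    also have "\<dots> = 2 * s ^ n + (1 - d) * cmod z ^ n"
      using \<open>d \<le> 1\<close> sn by (simp only: norm_mult norm_of_real norm_power abs_of_nonneg)
    also have "\<dots> \<le> 2 * 1 + 1 * 1"
      using d \<open>d \<le> 1\<close> z1[OF z] sn by (intro add_mono mult_mono) simp_all
    finally show "\<bar>?F z\<bar> \<le> 3 powr p"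
      using p by (simp add: powr_mono2)
  qed simp
  have M_int: "integrable \<mu> ?M"
  proof (rule integrable_bounded_on_disc[OF \<mu>(1,2) disc, of _ "2 powr p"])
    fix z :: complex assume z: "cmod z < 1"
    have "(1 - d) * cmod z ^ n \<le> 1 * 1"
      using d \<open>d \<le> 1\<close> z1[OF z] by (intro mult_mono) auto
    then show "\<bar>?M z\<bar> \<le> 2 powr p"
      using sn p by (simp add: powr_mono2)
  qed simp
  have L_int: "integrable \<mu> ?L"
    using G_int by (simp add: less_top[symmetric])
  \<comment> \<open>Since \<open>p < 1\<close> and \<open>1 - d\<close> lies in [0,1], the power
    only increases it. This keeps the loss linear in \<open>d\<close>.\<close>
  have pd: "1 - d \<le> (1 - d) powr p"
    using p d \<open>d \<le> 1\<close> powr_mono'[of p 1 "1 - d"] by simp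
  have LM: "?L z \<le> ?M z" for z
  proof (cases "z \<in> ball 0 s")
    \<comment> \<open>On the small disc \<open>?G z\<close> is at most s^(np), so adding the bonus
      (2^p - 1) s^(np) gives at most (2 s^n)^p, the contribution of the constant term alone.\<close>
    case True
    then have "cmod z ^ n \<le> s ^ n"
      using \<open>0 < s\<close> by (intro power_mono) auto
    then have "?G z \<le> (s ^ n) powr p"
      using p by (simp add: norm_power powr_mono2)
    then have "(1 - d) * ?G z \<le> 1 * (s ^ n) powr p"
      using d \<open>d \<le> 1\<close> by (intro mult_mono) auto
    moreover have "s powr (n * p) = (s ^ n) powr p"
      using \<open>0 < s\<close> by (simp add: powr_powr[symmetric] powr_realpow)
    ultimately have "?L z \<le> 2 powr p * (s ^ n) powr p"
      using True by (simp add: algebra_simps)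
    also have "\<dots> = (2 * s ^ n) powr p"
      using sn by (simp add: powr_mult)
    also have "\<dots> \<le> ?M z"
      using p sn by (intro powr_mono2) auto
    finally show ?thesis .
  next
    case False
    have "?L z \<le> (1 - d) powr p * ?G z"
      using False pd by (simp add: mult_right_mono)
    also have "\<dots> = ((1 - d) * cmod z ^ n) powr p"
      using \<open>d \<le> 1\<close> by (simp add: powr_mult norm_power)
    also have "\<dots> \<le> ?M z"
      using p \<open>d \<le> 1\<close> by (intro powr_mono2) auto
    finally show ?thesis .
  qed
  have "ennreal (\<integral>z. ?M z \<partial>\<mu>) \<le> ennreal (\<integral>z. ?F z \<partial>\<mu>)"
    using nn_integral_powr_binomial_ge[OF \<mu> p(1) \<open>n > 0\<close>, of "of_real (2 * s ^ n)" "of_real (1 - d)"]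
      M_int F_int sn \<open>d \<le> 1\<close>
    by (simp add: nn_integral_eq_integral norm_mult norm_power del: of_real_mult of_real_power of_real_diff)
  then have MF: "(\<integral>z. ?M z \<partial>\<mu>) \<le> (\<integral>z. ?F z \<partial>\<mu>)"
    by (simp add: Bochner_Integration.integral_nonneg)
  have GW: "(\<integral>z. ?G z \<partial>\<mu>) \<le> measure \<mu> (space \<mu>)"
  proof -
    have "(\<integral>z. ?G z \<partial>\<mu>) \<le> (\<integral>z. 1 \<partial>\<mu>)"
      using disc z1 p by (intro integral_mono_AE[OF G_int])
        (auto elim!: eventually_mono simp: norm_power powr_le1)
    then show ?thesis by simp
  qed
  have "d * (\<integral>z. ?G z \<partial>\<mu>) \<le> d * measure \<mu> (space \<mu>)"
    using d GW by (rule mult_left_mono[rotated])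
  \<comment> \<open>This is \<open>small\<close> divided by \<open>c ^ n\<close>, with
    \<open>d\<close> expanded.\<close>
  also have "\<dots> < ?g * (K * s\<^sup>2)"
    using small \<open>0 < c\<close> by (simp add: d_def power_divide field_simps)
  also have "\<dots> \<le> ?g * measure \<mu> (ball 0 s)"
    using K p2 by (intro mult_left_mono) auto
  finally have "(\<integral>z. ?G z \<partial>\<mu>) < (1 - d) * (\<integral>z. ?G z \<partial>\<mu>) + ?g * measure \<mu> (ball 0 s)"
    by (simp add: algebra_simps)
  also have "\<dots> = (\<integral>z. ?L z \<partial>\<mu>)"
    using G_int by (subst Bochner_Integration.integral_add) (auto simp: less_top[symmetric])
  also have "\<dots> \<le> (\<integral>z. ?M z \<partial>\<mu>)"
    using L_int M_int LM by (rule integral_mono)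
  finally show ?thesis
    using MF by simp
qed

section \<open>The weighted area measure of a radial weight\<close>

text \<open>Weights are only Lebesgue measurable, so the invariance is needed for the completed
  measure. It passes to the completion because \<open>lborel\<close> is its own image under
  rotation, whence null sets pull back to null sets.\<close>

lemma distr_lebesgue_rotation:
  fixes a :: complex
  assumes "cmod a = 1"
  shows "(*) a \<in> lebesgue \<rightarrow>\<^sub>M lebesgue" and "distr lebesgue lebesgue ((*) a) = lebesgue"
proof -
  have borel: "(*) a \<in> lborel \<rightarrow>\<^sub>M lborel"
    by simp
  have "distr lebesgue lborel ((*) a) = distr lborel lborel ((*) a)"
    using borel by (rule distr_completion)
  also have "\<dots> = distr lborel borel ((*) a)"
    by (rule distr_cong) simp_all
  finally have eq: "distr lebesgue lborel ((*) a) = lborel"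
    using distr_lborel_rotation[OF assms] by simp
  have m: "(*) a \<in> lebesgue \<rightarrow>\<^sub>M lborel"
    using borel by (rule measurable_completion)
  show "(*) a \<in> lebesgue \<rightarrow>\<^sub>M lebesgue"
    by (rule completion.measurable_completion2[OF m]) (simp add: eq)
  show "distr lebesgue lebesgue ((*) a) = lebesgue"
    using completion.completion_distr_eq[OF m] by (simp add: eq)
qed

text \<open>The measure w dA, carried from the Lebesgue sets of the disc to the Borel sets of the
  whole plane. There every rotation is a measurable self-map, and continuous functions are
  measurable without restriction to the disc.\<close>

definition weighted_area :: "(complex \<Rightarrow> real) \<Rightarrow> complex measure" where
  "weighted_area w = distr (density disc_area (\<lambda>z. ennreal (w z))) borel (\<lambda>z. z)"

lemma sets_weighted_area [simp]: "sets (weighted_area w) = sets borel"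
  and space_weighted_area [simp]: "space (weighted_area w) = UNIV"
  by (simp_all add: weighted_area_def)

lemma sets_disc_area [simp]: "sets disc_area = sets (lebesgue_on unit_disc)"
  and space_disc_area [simp]: "space disc_area = unit_disc"
  by (simp_all add: disc_area_def)

lemma measurable_disc_area_borel:
  "h \<in> borel_measurable borel \<Longrightarrow> h \<in> borel_measurable disc_area"
  by (simp add: disc_area_def measurable_completion measurable_restrict_space1)

lemma measurable_disc_area_weight:
  "weight w \<Longrightarrow> w \<in> borel_measurable disc_area"
  by (simp add: disc_area_def weight_def)

lemma measurable_weighted_area_id:
  "(\<lambda>z. z) \<in> density disc_area W \<rightarrow>\<^sub>M borel"
  using measurable_disc_area_borel[of "\<lambda>z. z"] by simp

text \<open>Unfolds the density and the restriction into one Lebesgue integral over the plane, the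
  form in which rotations can be substituted.\<close>

lemma emeasure_weighted_area:
  assumes "weight w" and A: "A \<in> sets borel"
  shows "emeasure (weighted_area w) A
    = (\<integral>\<^sup>+z. ennreal (1 / pi) * (ennreal (w z) * indicator A z) * indicator unit_disc z \<partial>lebesgue)"
proof -
  have A': "A \<inter> unit_disc \<in> sets disc_area"
    using A by (simp add: sets_restrict_space_iff sets.Int)
  have w: "(\<lambda>z. ennreal (w z)) \<in> borel_measurable disc_area"
    using measurable_disc_area_weight[OF assms(1)] by simp
  have ind: "(indicator A :: complex \<Rightarrow> ennreal) \<in> borel_measurable (lebesgue_on unit_disc)"
    using measurable_disc_area_borel[of "indicator A :: complex \<Rightarrow> ennreal"] A by (simp add: disc_area_def)
  have "emeasure (weighted_area w) A = (\<integral>\<^sup>+z. ennreal (w z) * indicator (A \<inter> unit_disc) z \<partial>disc_area)"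
    using w A A' measurable_weighted_area_id[of "\<lambda>z. ennreal (w z)"]
    by (simp add: weighted_area_def emeasure_distr emeasure_density)
  also have "\<dots> = (\<integral>\<^sup>+z. ennreal (w z) * indicator A z \<partial>disc_area)"
    by (intro nn_integral_cong) (auto simp: indicator_def)
  also have "\<dots> = (\<integral>\<^sup>+z. ennreal (1 / pi) * (ennreal (w z) * indicator A z) \<partial>lebesgue_on unit_disc)"
    using w ind unfolding disc_area_def by (subst nn_integral_density) simp_all
  also have "\<dots> = (\<integral>\<^sup>+z. ennreal (1 / pi) * (ennreal (w z) * indicator A z) * indicator unit_disc z \<partial>lebesgue)"
    by (subst nn_integral_restrict_space) simp_all
  finally show ?thesis .
qed

lemma finite_measure_weighted_area:
  assumes "integrable_weight w"
  shows "finite_measure (weighted_area w)"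
proof (rule finite_measureI)
  have "(\<lambda>z. ennreal (w z)) \<in> borel_measurable disc_area"
    using measurable_disc_area_weight[of w] assms by (simp add: integrable_weight_def)
  then have "emeasure (weighted_area w) (space (weighted_area w))
      = (\<integral>\<^sup>+z. ennreal (w z) * indicator unit_disc z \<partial>disc_area)"
    using measurable_weighted_area_id[of "\<lambda>z. ennreal (w z)"] sets.top[of disc_area]
    by (simp add: weighted_area_def emeasure_distr emeasure_density)
  also have "\<dots> = (\<integral>\<^sup>+z. ennreal (w z) \<partial>disc_area)"
    by (intro nn_integral_cong) simp
  finally have "emeasure (weighted_area w) (space (weighted_area w)) = (\<integral>\<^sup>+z. ennreal (w z) \<partial>disc_area)" .
  then show "emeasure (weighted_area w) (space (weighted_area w)) \<noteq> \<infinity>"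
    using assms by (simp add: integrable_weight_def less_top)
qed

lemma AE_weighted_area: "AE z in weighted_area w. cmod z < 1"
  unfolding weighted_area_def
  by (subst AE_distr_iff) (use measurable_weighted_area_id in \<open>auto intro!: AE_I2\<close>)

text \<open>The dictionary between \<open>weighted_area\<close> and the integrals that define the
  Bergman space and its norm.\<close>

lemma
  fixes h :: "complex \<Rightarrow> real"
  assumes w: "weight w" and h: "h \<in> borel_measurable borel"
  shows integral_weighted_area: "(\<integral>z. h z \<partial>weighted_area w) = (\<integral>z. h z * w z \<partial>disc_area)"
    and integrable_weighted_area: "integrable (weighted_area w) h \<longleftrightarrow> integrable disc_area (\<lambda>z. h z * w z)"
proof -
  have h': "h \<in> borel_measurable disc_area"
    using h by (rule measurable_disc_area_borel)
  have w': "w \<in> borel_measurable disc_area"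
    using w by (rule measurable_disc_area_weight)
  have nonneg: "AE z in disc_area. 0 \<le> w z"
    using w by (intro AE_I2) (auto simp: weight_def)
  show "(\<integral>z. h z \<partial>weighted_area w) = (\<integral>z. h z * w z \<partial>disc_area)"
    unfolding weighted_area_def integral_distr[OF measurable_weighted_area_id h]
    using integral_density[OF h' w' nonneg] by (simp add: mult.commute)
  show "integrable (weighted_area w) h \<longleftrightarrow> integrable disc_area (\<lambda>z. h z * w z)"
    unfolding weighted_area_def integrable_distr_eq[OF measurable_weighted_area_id h]
    using integrable_density[OF h' w' nonneg] by (simp add: mult.commute)
qed

text \<open>Both the disc and a radial \<open>w\<close> are unchanged by the rotation, so the
  integrand for the preimage of \<open>A\<close> is \<open>g (a * z)\<close>, and Lebesgue measure
  is itself rotation invariant.\<close>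

lemma distr_weighted_area_rotation:
  assumes w: "weight w" "radial w" and a: "cmod a = 1"
  shows "distr (weighted_area w) borel ((*) a) = weighted_area w"
proof (rule measure_eqI)
  fix A assume "A \<in> sets (distr (weighted_area w) borel ((*) a))"
  then have A: "A \<in> sets borel" by simp
  define g where "g z = ennreal (1 / pi) * (ennreal (w z) * indicator A z) * indicator unit_disc z" for z
  have pre: "(*) a -` A \<in> sets borel"
    using A by (intro measurable_sets_borel[of _ borel]) simp_all
  have "(\<lambda>z. ennreal (w z) * indicator A z) \<in> borel_measurable (lebesgue_on unit_disc)"
    using measurable_disc_area_weight[OF w(1)]
      measurable_disc_area_borel[of "indicator A :: complex \<Rightarrow> ennreal"] A
    by (simp add: disc_area_def)
  then have g: "g \<in> borel_measurable lebesgue"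
    unfolding g_def by (subst borel_measurable_restrict_space_iff_ennreal[symmetric]) simp_all
  have "w (a * z) = w z" if "cmod z < 1" for z
  proof -
    have "w (a * z) = w (of_real (cmod (a * z)))" "w z = w (of_real (cmod z))"
      using w(2) that a by (auto simp only: radial_def mem_ball_0 norm_mult mult_1)
    then show ?thesis
      using a by (simp only: norm_mult mult_1)
  qed
  then have *: "ennreal (1 / pi) * (ennreal (w z) * indicator ((*) a -` A) z) * indicator unit_disc z = g (a * z)" for z
    using a by (auto simp: g_def indicator_def norm_mult)
  have "emeasure (distr (weighted_area w) borel ((*) a)) A = emeasure (weighted_area w) ((*) a -` A)"
    using A by (subst emeasure_distr) (simp_all add: measurable_cong_sets[OF sets_weighted_area refl])
  also have "\<dots> = (\<integral>\<^sup>+z. g (a * z) \<partial>lebesgue)"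
    by (simp only: emeasure_weighted_area[OF w(1) pre] *)
  also have "\<dots> = (\<integral>\<^sup>+z. g z \<partial>distr lebesgue lebesgue ((*) a))"
    using distr_lebesgue_rotation(1)[OF a] g by (subst nn_integral_distr) simp_all
  also have "\<dots> = emeasure (weighted_area w) A"
    by (simp add: distr_lebesgue_rotation(2)[OF a] emeasure_weighted_area[OF w(1) A] g_def)
  finally show "emeasure (distr (weighted_area w) borel ((*) a)) A = emeasure (weighted_area w) A" .
qed simp

text \<open>The disc of radius \<open>s\<close> has normalized area s^2, and the weight is at least
  \<open>m\<close> on it.\<close>

lemma measure_weighted_area_ball_ge:
  assumes w: "integrable_weight w" "radial w"
    and m: "0 \<le> m" "\<And>r. 0 < r \<Longrightarrow> r < s \<Longrightarrow> m \<le> w (of_real r)" and s: "0 < s" "s \<le> 1"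
  shows "m * s\<^sup>2 \<le> measure (weighted_area w) (ball 0 s)"
proof -
  interpret finite_measure "weighted_area w"
    using w(1) by (rule finite_measure_weighted_area)
  have weight: "weight w"
    using w(1) by (simp add: integrable_weight_def)
  have "ennreal (m * s\<^sup>2) = ennreal (m / pi) * emeasure lborel (ball (0::complex) s)"
    using m(1) s(1) by (simp add: emeasure_ball unit_ball_vol_2 ennreal_mult[symmetric])
  also have "\<dots> = (\<integral>\<^sup>+z. ennreal (m / pi) * indicator (ball (0::complex) s) z \<partial>lborel)"
    by (simp add: nn_integral_cmult_indicator)
  also have "\<dots> \<le> (\<integral>\<^sup>+z. ennreal (1 / pi) * (ennreal (w z) * indicator (ball 0 s) z) * indicator unit_disc z \<partial>lborel)"
  proof (rule nn_integral_mono_AE)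
    \<comment> \<open>The bound on \<open>w\<close> is assumed for positive radii only; the origin
      is a null set.\<close>
    have "AE z::complex in lborel. z \<noteq> 0"
      by (rule AE_lborel_singleton)
    then show "AE z in lborel. ennreal (m / pi) * indicator (ball (0::complex) s) z
        \<le> ennreal (1 / pi) * (ennreal (w z) * indicator (ball 0 s) z) * indicator unit_disc z"
    proof eventually_elim
      case (elim z)
      show ?case
      proof (cases "z \<in> ball 0 s")
        case True
        then have "m \<le> w z"
          using elim m(2)[of "cmod z"] bspec[OF w(2)[unfolded radial_def], of z] s by simp
        then have "ennreal (m / pi) \<le> ennreal (1 / pi) * ennreal (w z)"
          using m(1) by (simp add: ennreal_mult[symmetric] divide_right_mono ennreal_leI)
        then show ?thesis
          using True s by simp
      qed simp
    qed
  qed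
  also have "\<dots> = emeasure (weighted_area w) (ball 0 s)"
    by (simp add: emeasure_weighted_area[OF weight] nn_integral_completion)
  finally show ?thesis
    using m(1) by (simp add: emeasure_eq_measure)
qed

section \<open>Choice of the parameters and failure of the domination principle\<close>

text \<open>The cost is of order s^n and the gain of order s^(2 + np). Once n (1 - p) > 2, the
  quotient is of order s^e with positive exponent e = n (1 - p) - 2, so every requirement holds for
  all small positive \<open>s\<close>.\<close>

lemma perturbation_scale_exists:
  fixes p c K W s0 :: real
  assumes p: "0 < p" "p < 1" and c: "0 < c" and "0 < K" and "0 \<le> W" and "0 < s0"
  obtains n :: nat and s :: real where "n > 0" "0 < s" "s < s0" "s < 1" "2 * (s / c) ^ n \<le> 1"
    "2 * W * s ^ n < c ^ n * (2 powr p - 1) * K * s\<^sup>2 * s powr (n * p)"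
proof -
  obtain n :: nat where "2 / (1 - p) < n"
    using reals_Archimedean2 by blast
  then have n: "2 < n * (1 - p)" "n > 0"
    using p by (auto simp: field_simps intro!: gr0I)
  define e where "e = n * (1 - p) - 2"
  have "e > 0"
    using n by (simp add: e_def)
  define C where "C = c ^ n * (2 powr p - 1) * K"
  have "1 < 2 powr p"
    using p by simp
  then have "C > 0"
    using c \<open>0 < K\<close> by (simp add: C_def)
  have lim: "((\<lambda>s::real. s) \<longlongrightarrow> 0) (at_right 0)"
    by (rule tendsto_ident_at)
  have lim1: "((\<lambda>s. 2 * W * s powr e) \<longlongrightarrow> 2 * W * 0 powr e) (at_right 0)"
  proof (intro tendsto_intros tendsto_powr' lim)
    have "\<forall>\<^sub>F s in at_right (0::real). 0 \<le> s"
      using eventually_at_right_less[of "0::real"] by (rule eventually_mono) simp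
    then show "(0::real) \<noteq> 0 \<or> 0 < e \<and> (\<forall>\<^sub>F s in at_right (0::real). 0 \<le> s)"
      using \<open>e > 0\<close> by blast
  qed
  have ev1: "\<forall>\<^sub>F s in at_right 0. 2 * W * s powr e < C"
    by (rule order_tendstoD(2)[OF lim1]) (use \<open>C > 0\<close> in simp)
  have lim2: "((\<lambda>s. 2 * (s / c) ^ n) \<longlongrightarrow> 2 * (0 / c) ^ n) (at_right 0)"
    using c by (intro tendsto_intros lim) simp
  have ev2: "\<forall>\<^sub>F s in at_right 0. 2 * (s / c) ^ n < 1"
    by (rule order_tendstoD(2)[OF lim2]) (use n in \<open>simp add: zero_power\<close>)
  have ev3: "\<forall>\<^sub>F s in at_right (0::real). s < min s0 1"
    using \<open>0 < s0\<close> by (intro order_tendstoD(2)[OF lim]) simp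
  have "\<forall>\<^sub>F s in at_right (0::real). 0 < s"
    by (rule eventually_at_right_less)
  with ev1 ev2 ev3 have "\<forall>\<^sub>F s in at_right 0. 2 * W * s powr e < C \<and> 2 * (s / c) ^ n < 1 \<and> s < min s0 1 \<and> 0 < s"
    by eventually_elim simp
  then obtain s where s: "2 * W * s powr e < C" "2 * (s / c) ^ n < 1" "s < min s0 1" "0 < s"
    using eventually_happens[of _ "at_right (0::real)"] by (auto simp: trivial_limit_at_right_real)
  have "s ^ n = s powr (e + 2 + n * p)"
    using s(4) by (simp add: e_def algebra_simps powr_realpow)
  also have "\<dots> = s powr e * (s\<^sup>2 * s powr (n * p))"
    using s(4) by (simp add: powr_add)
  finally have "2 * W * s ^ n = 2 * W * s powr e * (s\<^sup>2 * s powr (n * p))"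
    by simp
  also have "\<dots> < C * (s\<^sup>2 * s powr (n * p))"
    using s by (intro mult_strict_right_mono) simp_all
  finally show thesis
    using s n by (intro that[of n s]) (simp_all add: C_def mult.assoc)
qed

theorem theorem3:
  fixes p :: real and w :: "complex \<Rightarrow> real"
  assumes "0 < p" and "p < 1"
    and "integrable_weight w"
    and "radial w"
    and "Liminf (at_right 0) (\<lambda>r::real. ereal (w (complex_of_real r))) > 0"
  shows "\<forall>c::real. 0 < c \<and> c < 1 \<longrightarrow>
    (\<exists>f\<in>bergman_space p w. \<exists>g\<in>bergman_space p w.
      (\<forall>z. c \<le> cmod z \<and> cmod z < 1 \<longrightarrow> cmod (f z) \<le> cmod (g z)) \<and>
      bergman_norm p w f > bergman_norm p w g)"
proof (intro allI impI)
  fix c :: real assume c: "0 < c \<and> c < 1"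
  let ?\<mu> = "weighted_area w"
  have weight: "weight w"
    using assms(3) by (simp add: integrable_weight_def)
  note \<mu> = finite_measure_weighted_area[OF assms(3)] sets_weighted_area[of w]
    distr_weighted_area_rotation[OF weight assms(4)]
  \<comment> \<open>Any number strictly between 0 and the lower limit bounds the weight from below
    near the origin.\<close>
  obtain m where m: "0 < m" "ereal m < Liminf (at_right 0) (\<lambda>r::real. ereal (w (of_real r)))"
    using ereal_dense2[OF assms(5)] by auto
  have "\<forall>\<^sub>F r in at_right (0::real). m < w (of_real r)"
    using less_LiminfD[OF m(2)] by simp
  then obtain s0 where s0: "0 < s0" "\<And>r. 0 < r \<Longrightarrow> r < s0 \<Longrightarrow> m < w (of_real r)"
    by (auto simp: eventually_at_right_field)
  from c have "0 < c" by simp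
  from perturbation_scale_exists[OF assms(1,2) this m(1) measure_nonneg[of ?\<mu> "space ?\<mu>"] s0(1)]
  obtain n s where ns: "n > 0" "0 < s" "s < s0" "s < 1" "2 * (s / c) ^ n \<le> 1"
    "2 * measure ?\<mu> (space ?\<mu>) * s ^ n < c ^ n * (2 powr p - 1) * m * s\<^sup>2 * s powr (n * p)"
    by blast
  \<comment> \<open>This makes d c^n = 2 s^n, so that \<open>f\<close> is the combination (1 - d)
    z^n + d c^n.\<close>
  define d where "d = 2 * (s / c) ^ n"
  define f :: "complex \<Rightarrow> complex" where "f z = of_real (2 * s ^ n) + of_real (1 - d) * z ^ n" for z
  define g :: "complex \<Rightarrow> complex" where "g z = z ^ n" for z
  have d: "0 \<le> d" "d \<le> 1"
    using ns c by (simp_all add: d_def)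
  have f_le: "cmod (f z) \<le> 2 * s ^ n + (1 - d) * cmod z ^ n" for z
  proof -
    have "cmod (f z) \<le> cmod (of_real (2 * s ^ n)) + cmod (of_real (1 - d) * z ^ n)"
      unfolding f_def by (rule norm_triangle_ineq)
    also have "\<dots> = 2 * s ^ n + (1 - d) * cmod z ^ n"
      using d ns by (simp only: norm_mult norm_of_real norm_power abs_of_nonneg) simp
    finally show ?thesis .
  qed
  \<comment> \<open>Bounded entire functions on the disc suffice, as w dA is finite; the bound 3
    serves both \<open>f\<close> and \<open>g\<close>.\<close>
  have bergman: "h \<in> bergman_space p w"
    if "h holomorphic_on UNIV" "\<And>z. cmod z < 1 \<Longrightarrow> cmod (h z) \<le> 3" for h
  proof -
    have "continuous_on UNIV h"
      using that(1) by (rule holomorphic_on_imp_continuous_on)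
    then have [measurable]: "h \<in> borel_measurable borel"
      by (rule borel_measurable_continuous_onI)
    have "integrable ?\<mu> (\<lambda>z. cmod (h z) powr p)"
      using that(2) assms(1)
      by (intro integrable_bounded_on_disc[OF \<mu>(1,2) AE_weighted_area, of _ "3 powr p"])
        (auto intro!: powr_mono2)
    then show ?thesis
      using that(1) by (auto simp: bergman_space_def integrable_weighted_area[OF weight] intro: holomorphic_on_subset)
  qed
  have zn: "cmod z ^ n \<le> 1" if "cmod z < 1" for z :: complex
    using that by (simp add: power_le_one)
  have sn: "s ^ n \<le> 1"
    using ns by (simp add: power_le_one)
  have "f \<in> bergman_space p w"
  proof (rule bergman)
    show "f holomorphic_on UNIV"
      unfolding f_def by (intro holomorphic_intros)
    fix z :: complex assume z: "cmod z < 1"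
    have "(1 - d) * cmod z ^ n \<le> 1 * 1"
      using d zn[OF z] by (intro mult_mono) simp_all
    then show "cmod (f z) \<le> 3"
      using f_le[of z] sn by simp
  qed
  moreover have "g \<in> bergman_space p w"
  proof (rule bergman)
    show "g holomorphic_on UNIV"
      unfolding g_def by (intro holomorphic_intros)
    show "cmod (g z) \<le> 3" if "cmod z < 1" for z
      using zn[OF that] by (simp add: g_def norm_power)
  qed
  moreover have "cmod (f z) \<le> cmod (g z)" if "c \<le> cmod z" for z
  proof -
    \<comment> \<open>Outside radius \<open>c\<close> the constant term d c^n is at most d |z|^n,
      which restores exactly the share removed from z^n.\<close>
    have "(s / c) ^ n * c ^ n \<le> (s / c) ^ n * cmod z ^ n"
      using that c ns by (intro mult_left_mono power_mono) simp_all
    then have "2 * s ^ n \<le> d * cmod z ^ n"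
      using c by (simp add: d_def power_divide)
    then show ?thesis
      using f_le[of z] by (simp add: g_def norm_power algebra_simps)
  qed
  moreover have "bergman_norm p w g < bergman_norm p w f"
  proof -
    have "m * s\<^sup>2 \<le> measure ?\<mu> (ball 0 s)"
      using m(1) ns s0 by (intro measure_weighted_area_ball_ge[OF assms(3,4)]) (auto intro: less_imp_le)
    from integral_perturbation_gt[OF \<mu> AE_weighted_area assms(1,2) ns(1) _ ns(2,4,5) this ns(6)]
    have "(\<integral>z. cmod (g z) powr p \<partial>?\<mu>) < (\<integral>z. cmod (f z) powr p \<partial>?\<mu>)"
      using c by (simp add: f_def g_def d_def)
    moreover have "bergman_norm p w h = (\<integral>z. cmod (h z) powr p \<partial>?\<mu>) powr (1 / p)"
      if "h \<in> borel_measurable borel" for h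
      using that by (simp add: bergman_norm_def integral_weighted_area[OF weight])
    moreover have "f \<in> borel_measurable borel" "g \<in> borel_measurable borel"
      by (simp_all add: f_def[abs_def] g_def[abs_def])
    ultimately show ?thesis
      using assms(1) by (simp add: powr_less_mono2 Bochner_Integration.integral_nonneg)
  qed
  ultimately show "\<exists>f\<in>bergman_space p w. \<exists>g\<in>bergman_space p w.
      (\<forall>z. c \<le> cmod z \<and> cmod z < 1 \<longrightarrow> cmod (f z) \<le> cmod (g z)) \<and>
      bergman_norm p w f > bergman_norm p w g"
    by blast
qed

end
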